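(* Let $D\subset\mathbb{R}$, $\phi_0\in\mathbb{R}\setminus D$, let $C\subset\mathbb{R}^T$ be a fixed measurable set, and let $\pi_1$ be a probability distribution on $(0,\infty)$. Consider testing problems with $N$ hypotheses in which $\phi_1,\dots,\phi_N\in D\cup\{\phi_0\}$ are fixed (non-random) and $\sigma_1,\dots,\sigma_N$ are i.i.d. random variables with distribution $\pi_1$. Let $N_1=\#\{j:\phi_j\in D\}$ and $N-N_1=\#\{j:\phi_j=\phi_0\}$, and let $\mathrm{ETP}$ and $\mathrm{EFP}$ be the (random, through the $\sigma_j$) quantities $$\mathrm{ETP}=\sum_{\{j\mid\phi_j\in D\}}P_{\phi_j,\sigma_j}({\bf y}_j\in C),\qquad \mathrm{EFP}=\sum_{\{j\mid\phi_j=\phi_0\}}P_{\phi_j,\sigma_j}({\bf y}_j\in C).$$ Put $$\mathrm{BETP}=\frac1{N_1}\sum_{\{j\mid\phi_j\in D\}}\int P_{\phi_j,\sigma}({\bf y}\in C)\,d\pi_1(\sigma),\qquad \mathrm{BEFP}=\int P_{\phi_0,\sigma}({\bf y}\in C)\,d\pi_1(\sigma).$$ Then, along any sequence of such problems with $N_1\to\infty$ and $N-N_1\to\infty$, $$\frac{\mathrm{ETP}}{N_1}-\mathrm{BETP}\longrightarrow 0\quad\text{in probability}\qquad\text{and}\qquad \frac{\mathrm{EFP}}{N-N_1}-\mathrm{BEFP}\longrightarrow 0\quad\text{in probability}.$$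
   Context: For parameters $\phi\in\mathbb{R}$, $\sigma>0$, $f(\cdot\mid\phi,\sigma)$ is a probability density on $\mathbb{R}^T$, jointly measurable in its arguments, and $P_{\phi,\sigma}({\bf y}\in C)=\int_{C}f({\bf y}\mid\phi,\sigma)\,d{\bf y}$. The $j$-th observation ${\bf y}_j$ has density $f(\cdot\mid\phi_j,\sigma_j)$ given its parameters. The hypotheses are $H_0^j:\phi_j=\phi_0$ versus $H_1^j:\phi_j\in D$, $j=1,\dots,N$, and the procedure rejects $H_0^j$ if and only if ${\bf y}_j\in C$, with the same $C$ for all $j$. ETP is the expected number of true positives and EFP the expected number of false positives, for given parameters. *)

theory Defs
  imports "HOL-Probability.Probability"
begin

(* R^T carries its Lebesgue sigma-algebra, which contains the Borel one, so Borel measurable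
   densities and Borel rejection regions are covered. *)

definition density_family :: "(real \<Rightarrow> real \<Rightarrow> real ^ 'T \<Rightarrow> real) \<Rightarrow> bool" where
  "density_family f \<longleftrightarrow>
     (\<lambda>(\<phi>, \<sigma>, y). f \<phi> \<sigma> y) \<in>
       borel_measurable (borel \<Otimes>\<^sub>M restrict_space borel {0<..} \<Otimes>\<^sub>M lebesgue) \<and>
     (\<forall>\<phi>. \<forall>\<sigma>>0. (\<forall>y. 0 \<le> f \<phi> \<sigma> y) \<and> (\<integral>\<^sup>+ y. ennreal (f \<phi> \<sigma> y) \<partial>lebesgue) = 1)"

definition obs_prob ::
  "(real \<Rightarrow> real \<Rightarrow> real ^ 'T \<Rightarrow> real) \<Rightarrow> real \<Rightarrow> real \<Rightarrow> (real ^ 'T) set \<Rightarrow> real" where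
  "obs_prob f \<phi> \<sigma> C = (LINT y:C|lebesgue. f \<phi> \<sigma> y)"

(* A problem consists of the hypotheses 1, ..., N with parameters \<phi> 1, ..., \<phi> N. *)

definition alternatives :: "real set \<Rightarrow> nat \<Rightarrow> (nat \<Rightarrow> real) \<Rightarrow> nat set" where
  "alternatives D N \<phi> = {j \<in> {1..N}. \<phi> j \<in> D}"

definition nulls :: "real \<Rightarrow> nat \<Rightarrow> (nat \<Rightarrow> real) \<Rightarrow> nat set" where
  "nulls \<phi>\<^sub>0 N \<phi> = {j \<in> {1..N}. \<phi> j = \<phi>\<^sub>0}"

definition ETP ::
  "(real \<Rightarrow> real \<Rightarrow> real ^ 'T \<Rightarrow> real) \<Rightarrow> (real ^ 'T) set \<Rightarrow> real set \<Rightarrow> nat \<Rightarrow>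
   (nat \<Rightarrow> real) \<Rightarrow> (nat \<Rightarrow> real) \<Rightarrow> real" where
  "ETP f C D N \<phi> \<sigma> = (\<Sum>j \<in> alternatives D N \<phi>. obs_prob f (\<phi> j) (\<sigma> j) C)"

definition EFP ::
  "(real \<Rightarrow> real \<Rightarrow> real ^ 'T \<Rightarrow> real) \<Rightarrow> (real ^ 'T) set \<Rightarrow> real \<Rightarrow> nat \<Rightarrow>
   (nat \<Rightarrow> real) \<Rightarrow> (nat \<Rightarrow> real) \<Rightarrow> real" where
  "EFP f C \<phi>\<^sub>0 N \<phi> \<sigma> = (\<Sum>j \<in> nulls \<phi>\<^sub>0 N \<phi>. obs_prob f (\<phi> j) (\<sigma> j) C)"

definition BETP ::
  "(real \<Rightarrow> real \<Rightarrow> real ^ 'T \<Rightarrow> real) \<Rightarrow> (real ^ 'T) set \<Rightarrow> real set \<Rightarrow> real measure \<Rightarrow> nat \<Rightarrow>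
   (nat \<Rightarrow> real) \<Rightarrow> real" where
  "BETP f C D \<pi>\<^sub>1 N \<phi> =
     1 / real (card (alternatives D N \<phi>)) *
     (\<Sum>j \<in> alternatives D N \<phi>. \<integral>\<sigma>. obs_prob f (\<phi> j) \<sigma> C \<partial>\<pi>\<^sub>1)"

definition BEFP ::
  "(real \<Rightarrow> real \<Rightarrow> real ^ 'T \<Rightarrow> real) \<Rightarrow> (real ^ 'T) set \<Rightarrow> real \<Rightarrow> real measure \<Rightarrow> real" where
  "BEFP f C \<phi>\<^sub>0 \<pi>\<^sub>1 = (\<integral>\<sigma>. obs_prob f \<phi>\<^sub>0 \<sigma> C \<partial>\<pi>\<^sub>1)"

(* The n-th variable lives on its own probability space M n. Measurability is required because
   measure (M n) is 0 on sets that are not measurable. *)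

definition tendsto_zero_in_prob :: "(nat \<Rightarrow> 'a measure) \<Rightarrow> (nat \<Rightarrow> 'a \<Rightarrow> real) \<Rightarrow> bool" where
  "tendsto_zero_in_prob M X \<longleftrightarrow>
     (\<forall>n. X n \<in> borel_measurable (M n)) \<and>
     (\<forall>\<epsilon>>0. (\<lambda>n. measure (M n) {\<omega> \<in> space (M n). \<bar>X n \<omega>\<bar> > \<epsilon>}) \<longlonglongrightarrow> 0)"

end

theory Submission
  imports Defs
begin

text \<open>
  The rejection probability is a measurable function of \<open>\<sigma>\<close> with values in \<open>[0, 1]\<close>, so ETP and
  EFP are sums of independent \<open>[0, 1]\<close>-valued random variables whose means add up to \<open>N\<^sub>1\<close> BETP and
  \<open>(N - N\<^sub>1)\<close> BEFP. Hoeffding's inequality bounds the probability that the average of \<open>m\<close> such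
  variables deviates from its mean by more than \<open>\<epsilon>\<close> by \<open>2 exp (- 2 m \<epsilon>\<^sup>2)\<close>, uniformly in
  their distributions, which are different in each problem of the sequence.
\<close>

text \<open>Completion leaves the measure of Borel sets unchanged, so a countable cover witnessing
  sigma-finiteness of \<open>lborel\<close> also serves here. This makes integrals over
  \<open>lebesgue\<close> measurable in a parameter.\<close>

lemma sigma_finite_lebesgue: "sigma_finite_measure (lebesgue :: 'a::euclidean_space measure)"
proof
  obtain A :: "'a set set" where A: "countable A" "A \<subseteq> sets lborel" "\<Union>A = space lborel"
      "\<forall>a\<in>A. emeasure lborel a \<noteq> \<infinity>"
    using lborel.sigma_finite_countable by blast
  have "\<forall>a\<in>A. emeasure lebesgue a \<noteq> \<infinity>"
    using A(2,4) by (auto simp: subset_iff)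
  moreover have "A \<subseteq> sets lebesgue"
    using A(2) by (meson sets_completionI_sets subset_iff)
  ultimately show "\<exists>A::'a set set. countable A \<and> A \<subseteq> sets lebesgue \<and> \<Union>A = space lebesgue \<and>
      (\<forall>a\<in>A. emeasure lebesgue a \<noteq> \<infinity>)"
    using A(1,3) by (intro exI[of _ A]) simp
qed

lemma
  fixes f :: "real \<Rightarrow> real \<Rightarrow> real ^ 'T \<Rightarrow> real"
  assumes f: "density_family f" and \<sigma>: "\<sigma> > 0"
  shows density_family_integrable: "integrable lebesgue (f \<phi> \<sigma>)"
    and density_family_integral: "(\<integral>y. f \<phi> \<sigma> y \<partial>lebesgue) = 1"
proof -
  \<comment> \<open>The section lands in the product space because \<sigma> > 0 puts \<sigma> in the
    space of the restricted middle factor.\<close>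
  have "(\<lambda>y. (\<phi>, \<sigma>, y)) \<in> lebesgue \<rightarrow>\<^sub>M
      borel \<Otimes>\<^sub>M restrict_space borel {0<..} \<Otimes>\<^sub>M (lebesgue :: (real ^ 'T) measure)"
    using \<sigma> by (intro measurable_Pair measurable_const measurable_ident_sets)
      (auto simp: space_restrict_space)
  from measurable_compose[OF this f[unfolded density_family_def, THEN conjunct1]]
  have meas: "f \<phi> \<sigma> \<in> borel_measurable lebesgue"
    by simp
  have nonneg: "AE y in lebesgue. 0 \<le> f \<phi> \<sigma> y"
    and total: "(\<integral>\<^sup>+ y. ennreal (f \<phi> \<sigma> y) \<partial>lebesgue) = ennreal 1"
    using f \<sigma> by (simp_all add: density_family_def)
  show "integrable lebesgue (f \<phi> \<sigma>)"
    using meas nonneg total by (rule integrableI_nn_integral_finite)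
  show "(\<integral>y. f \<phi> \<sigma> y \<partial>lebesgue) = 1"
    using integral_eq_nn_integral[OF meas nonneg] total by simp
qed

lemma obs_prob_in_unit_interval:
  assumes f: "density_family f" and \<sigma>: "\<sigma> > 0"
  shows "obs_prob f \<phi> \<sigma> C \<in> {0..1}"
proof -
  have nonneg: "0 \<le> f \<phi> \<sigma> y" for y
    using f \<sigma> by (simp add: density_family_def)
  \<comment> \<open>Only the dominating density has to be integrable for this comparison. Were the
    integrand cut off by \<open>C\<close> not integrable, its integral would be 0 by convention,
    which is still below the bound.\<close>
  have "obs_prob f \<phi> \<sigma> C \<le> (\<integral>y. f \<phi> \<sigma> y \<partial>lebesgue)"
    unfolding obs_prob_def set_lebesgue_integral_def
    by (intro integral_mono' density_family_integrable[OF f \<sigma>])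
      (auto simp: nonneg indicator_def)
  moreover have "0 \<le> obs_prob f \<phi> \<sigma> C"
    unfolding obs_prob_def set_lebesgue_integral_def
    by (intro integral_nonneg_AE AE_I2) (simp add: nonneg)
  ultimately show ?thesis
    by (simp add: density_family_integral[OF f \<sigma>])
qed

text \<open>The measurability half of Fubini's theorem: fixing \<phi> in the jointly measurable
  density leaves a function of the pair (\<sigma>, y), and integrating out y keeps measurability in
  \<sigma>.\<close>

lemma obs_prob_measurable:
  fixes f :: "real \<Rightarrow> real \<Rightarrow> real ^ 'T \<Rightarrow> real"
  assumes f: "density_family f" and C[measurable]: "C \<in> sets lebesgue"
  shows "(\<lambda>\<sigma>. obs_prob f \<phi> \<sigma> C) \<in> borel_measurable (restrict_space borel {0<..})"
proof -
  interpret sigma_finite_measure "lebesgue :: (real ^ 'T) measure"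
    by (rule sigma_finite_lebesgue)
  let ?S = "restrict_space borel {0<..} :: real measure"
  have "(\<lambda>p. (\<phi>, p)) \<in> ?S \<Otimes>\<^sub>M lebesgue \<rightarrow>\<^sub>M
      borel \<Otimes>\<^sub>M ?S \<Otimes>\<^sub>M (lebesgue :: (real ^ 'T) measure)"
    by simp
  from measurable_compose[OF this f[unfolded density_family_def, THEN conjunct1]]
  have [measurable]: "(\<lambda>p. f \<phi> (fst p) (snd p)) \<in> borel_measurable (?S \<Otimes>\<^sub>M lebesgue)"
    by (simp add: case_prod_beta)
  have "(\<lambda>p. indicator C (snd p) *\<^sub>R f \<phi> (fst p) (snd p)) \<in> borel_measurable (?S \<Otimes>\<^sub>M lebesgue)"
    by measurable
  then show ?thesis
    unfolding obs_prob_def set_lebesgue_integral_def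
    by (intro borel_measurable_lebesgue_integral) (simp add: case_prod_beta)
qed

text \<open>Rows of the array need not be related to each other, so the limit must come from a bound
  within each row that depends on its length only. Writing \<open>mean\<close> as a product instead
  of a quotient keeps it meaningful for an empty row.\<close>

lemma weak_law_triangular_array:
  fixes X :: "nat \<Rightarrow> 'i \<Rightarrow> 'a \<Rightarrow> real"
  assumes prob: "\<And>n. prob_space (M n)"
    and fin: "\<And>n. finite (I n)"
    and indep: "\<And>n. prob_space.indep_vars (M n) (\<lambda>_. borel) (X n) (I n)"
    and bounded: "\<And>n i \<omega>. i \<in> I n \<Longrightarrow> \<omega> \<in> space (M n) \<Longrightarrow> X n i \<omega> \<in> {0..1}"
    and mean: "\<And>n. (\<Sum>i\<in>I n. \<integral>\<omega>. X n i \<omega> \<partial>M n) = real (card (I n)) * \<mu> n"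
    and card: "filterlim (\<lambda>n. card (I n)) at_top sequentially"
  shows "tendsto_zero_in_prob M (\<lambda>n \<omega>. (\<Sum>i\<in>I n. X n i \<omega>) / real (card (I n)) - \<mu> n)"
  unfolding tendsto_zero_in_prob_def
proof (intro conjI allI impI)
  fix n
  have [measurable]: "X n i \<in> borel_measurable (M n)" if "i \<in> I n" for i
    using indep[of n] that by (simp add: prob_space.indep_vars_def[OF prob])
  show "(\<lambda>\<omega>. (\<Sum>i\<in>I n. X n i \<omega>) / real (card (I n)) - \<mu> n) \<in> borel_measurable (M n)"
    by measurable
next
  fix \<epsilon> :: real
  assume \<epsilon>: "\<epsilon> > 0"
  let ?dev = "\<lambda>n \<omega>. (\<Sum>i\<in>I n. X n i \<omega>) / real (card (I n)) - \<mu> n"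
  \<comment> \<open>An empty row is excluded because the Hoeffding exponent divides by the sum of
    squared interval lengths, here the row length.\<close>
  have bound: "measure (M n) {\<omega> \<in> space (M n). \<bar>?dev n \<omega>\<bar> > \<epsilon>}
      \<le> 2 * exp (- 2 * \<epsilon>\<^sup>2 * real (card (I n)))" if pos: "card (I n) > 0" for n
  proof -
    interpret Hoeffding_ineq "M n" "I n" "X n" "\<lambda>_. 0" "\<lambda>_. 1" "\<Sum>i\<in>I n. \<integral>\<omega>. X n i \<omega> \<partial>M n"
      by (intro Hoeffding_ineq.intro indep_interval_bounded_random_variables.intro
          indep_interval_bounded_random_variables_axioms.intro prob fin indep AE_I2 bounded)
    have [measurable]: "X n i \<in> borel_measurable (M n)" if "i \<in> I n" for i
      using that by (rule random_variable)
    have "(\<Sum>i\<in>I n. X n i \<omega>) - (\<Sum>i\<in>I n. \<integral>\<omega>. X n i \<omega> \<partial>M n) =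
        ?dev n \<omega> * real (card (I n))" for \<omega>
      unfolding mean using pos by (simp add: left_diff_distrib)
    then have "\<bar>(\<Sum>i\<in>I n. X n i \<omega>) - (\<Sum>i\<in>I n. \<integral>\<omega>. X n i \<omega> \<partial>M n)\<bar> =
        \<bar>?dev n \<omega>\<bar> * real (card (I n))" for \<omega>
      by (simp only: abs_mult abs_of_nat)
    then have "measure (M n) {\<omega> \<in> space (M n). \<bar>?dev n \<omega>\<bar> > \<epsilon>} \<le>
        measure (M n) {\<omega> \<in> space (M n).
          \<bar>(\<Sum>i\<in>I n. X n i \<omega>) - (\<Sum>i\<in>I n. \<integral>\<omega>. X n i \<omega> \<partial>M n)\<bar> \<ge> \<epsilon> * real (card (I n))}"
      using pos by (intro finite_measure_mono) auto
    also have "\<dots> \<le> 2 * exp (- 2 * (\<epsilon> * real (card (I n)))\<^sup>2 / (\<Sum>i\<in>I n. (1 - 0)\<^sup>2))"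
      using \<epsilon> pos by (intro Hoeffding_ineq_abs_ge) auto
    \<comment> \<open>With m the row length, the threshold \<epsilon> m gives the exponent - 2
      (\<epsilon> m)^2 / m.\<close>
    also have "\<dots> = 2 * exp (- 2 * \<epsilon>\<^sup>2 * real (card (I n)))"
      using pos by (simp add: power2_eq_square)
    finally show ?thesis .
  qed
  have "filterlim (\<lambda>n. real (card (I n))) at_top sequentially"
    using filterlim_compose[OF filterlim_real_sequentially card] .
  then have "filterlim (\<lambda>n. - 2 * \<epsilon>\<^sup>2 * real (card (I n))) at_bot sequentially"
    using \<epsilon> by (intro filterlim_tendsto_neg_mult_at_bot[OF tendsto_const]) auto
  then have "(\<lambda>n. exp (- 2 * \<epsilon>\<^sup>2 * real (card (I n)))) \<longlonglongrightarrow> 0"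
    by (rule filterlim_compose[OF exp_at_bot])
  then have lim: "(\<lambda>n. 2 * exp (- 2 * \<epsilon>\<^sup>2 * real (card (I n)))) \<longlonglongrightarrow> 0"
    by (rule tendsto_mult_right_zero)
  \<comment> \<open>Rows of length 0 occur only finitely often and do not affect the limit.\<close>
  have "\<forall>\<^sub>F n in sequentially. card (I n) > 0"
    using card[unfolded filterlim_at_top, rule_format, of 1] by (simp add: Suc_le_eq)
  then have "\<forall>\<^sub>F n in sequentially.
      measure (M n) {\<omega> \<in> space (M n). \<bar>?dev n \<omega>\<bar> > \<epsilon>}
        \<le> 2 * exp (- 2 * \<epsilon>\<^sup>2 * real (card (I n)))"
    by (rule eventually_mono) (rule bound)
  then show "(\<lambda>n. measure (M n) {\<omega> \<in> space (M n). \<bar>?dev n \<omega>\<bar> > \<epsilon>}) \<longlonglongrightarrow> 0"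
    by (intro tendsto_sandwich[OF _ _ tendsto_const lim]) auto
qed

theorem theorem1:
  fixes f :: "real \<Rightarrow> real \<Rightarrow> real ^ 'T \<Rightarrow> real"
    and D :: "real set" and \<phi>\<^sub>0 :: real and C :: "(real ^ 'T) set"
    and \<pi>\<^sub>1 :: "real measure"
    and N :: "nat \<Rightarrow> nat" and \<phi> :: "nat \<Rightarrow> nat \<Rightarrow> real"
    and M :: "nat \<Rightarrow> 'a measure" and \<sigma> :: "nat \<Rightarrow> nat \<Rightarrow> 'a \<Rightarrow> real"
  assumes "density_family f"
    and "\<phi>\<^sub>0 \<notin> D"
    and "C \<in> sets lebesgue"
    and "prob_space \<pi>\<^sub>1" and "sets \<pi>\<^sub>1 = sets (restrict_space borel {0<..})"
    and "\<And>n j. j \<in> {1..N n} \<Longrightarrow> \<phi> n j \<in> D \<union> {\<phi>\<^sub>0}"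
    and "\<And>n. prob_space (M n)"
    and "\<And>n. prob_space.indep_vars (M n) (\<lambda>_. \<pi>\<^sub>1) (\<sigma> n) {1..N n}"
    and "\<And>n j. j \<in> {1..N n} \<Longrightarrow> distr (M n) \<pi>\<^sub>1 (\<sigma> n j) = \<pi>\<^sub>1"
    and "filterlim (\<lambda>n. card (alternatives D (N n) (\<phi> n))) at_top sequentially"
    and "filterlim (\<lambda>n. card (nulls \<phi>\<^sub>0 (N n) (\<phi> n))) at_top sequentially"
  shows "tendsto_zero_in_prob M
           (\<lambda>n \<omega>. ETP f C D (N n) (\<phi> n) (\<lambda>j. \<sigma> n j \<omega>) / real (card (alternatives D (N n) (\<phi> n)))
                   - BETP f C D \<pi>\<^sub>1 (N n) (\<phi> n)) \<and>
         tendsto_zero_in_prob M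
           (\<lambda>n \<omega>. EFP f C \<phi>\<^sub>0 (N n) (\<phi> n) (\<lambda>j. \<sigma> n j \<omega>) / real (card (nulls \<phi>\<^sub>0 (N n) (\<phi> n)))
                   - BEFP f C \<phi>\<^sub>0 \<pi>\<^sub>1)"
proof -
  let ?g = "\<lambda>n j \<sigma>. obs_prob f (\<phi> n j) \<sigma> C"
  have meas: "?g n j \<in> borel_measurable \<pi>\<^sub>1" for n j
    using obs_prob_measurable[OF assms(1,3)] measurable_cong_sets[OF assms(5) refl] by blast
  have space: "space \<pi>\<^sub>1 = {0<..}"
    using sets_eq_imp_space_eq[OF assms(5)] by (simp add: space_restrict_space)
  have \<sigma>_meas: "\<sigma> n j \<in> M n \<rightarrow>\<^sub>M \<pi>\<^sub>1" if "j \<in> {1..N n}" for n j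
    using assms(8)[of n] that by (simp add: prob_space.indep_vars_def[OF assms(7)])
  have mean: "(\<integral>\<omega>. ?g n j (\<sigma> n j \<omega>) \<partial>M n) = (\<integral>\<sigma>. ?g n j \<sigma> \<partial>\<pi>\<^sub>1)" if "j \<in> {1..N n}" for n j
    using integral_distr[OF \<sigma>_meas[OF that] meas[of n j]] assms(9)[OF that] by simp
  \<comment> \<open>Both claims are instances: \<open>I\<close> is the set of alternatives or of
    nulls, and the centre \<mu> may change with n, as BETP does.\<close>
  have law: "tendsto_zero_in_prob M (\<lambda>n \<omega>.
      (\<Sum>j\<in>I n. ?g n j (\<sigma> n j \<omega>)) / real (card (I n)) - \<mu> n)"
    if sub: "\<And>n. I n \<subseteq> {1..N n}" and card: "filterlim (\<lambda>n. card (I n)) at_top sequentially"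
      and \<mu>: "\<And>n. (\<Sum>j\<in>I n. \<integral>\<sigma>. ?g n j \<sigma> \<partial>\<pi>\<^sub>1) = real (card (I n)) * \<mu> n" for I \<mu>
  proof (rule weak_law_triangular_array[OF assms(7) _ _ _ _ card])
    fix n
    show "finite (I n)"
      using sub by (rule finite_subset) simp
    have "(\<Sum>j\<in>I n. \<integral>\<omega>. ?g n j (\<sigma> n j \<omega>) \<partial>M n) = (\<Sum>j\<in>I n. \<integral>\<sigma>. ?g n j \<sigma> \<partial>\<pi>\<^sub>1)"
      using sub[of n] by (intro sum.cong refl mean) auto
    with \<mu> show "(\<Sum>j\<in>I n. \<integral>\<omega>. ?g n j (\<sigma> n j \<omega>) \<partial>M n) = real (card (I n)) * \<mu> n"
      by simp
    \<comment> \<open>Independence passes to subfamilies and survives a different measurable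
      transformation of each variable.\<close>
    show "prob_space.indep_vars (M n) (\<lambda>_. borel) (\<lambda>j \<omega>. ?g n j (\<sigma> n j \<omega>)) (I n)"
      using prob_space.indep_vars_compose2[OF assms(7)
          prob_space.indep_vars_subset[OF assms(7) assms(8) sub] meas] .
    fix j \<omega> assume "j \<in> I n" "\<omega> \<in> space (M n)"
    then have "\<sigma> n j \<omega> \<in> space \<pi>\<^sub>1"
      using sub[of n] by (intro measurable_space[OF \<sigma>_meas]) auto
    then have "\<sigma> n j \<omega> > 0"
      by (simp add: space)
    then show "?g n j (\<sigma> n j \<omega>) \<in> {0..1}"
      by (rule obs_prob_in_unit_interval[OF assms(1)])
  qed
  have "tendsto_zero_in_prob M (\<lambda>n \<omega>. ETP f C D (N n) (\<phi> n) (\<lambda>j. \<sigma> n j \<omega>) /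
      real (card (alternatives D (N n) (\<phi> n))) - BETP f C D \<pi>\<^sub>1 (N n) (\<phi> n))"
    unfolding ETP_def
  proof (rule law[OF _ assms(10)])
    fix n
    \<comment> \<open>Finiteness ensures that cardinality 0 means an empty set, so both sides below
      vanish in that case; otherwise the factor 1 / card cancels.\<close>
    have "finite (alternatives D (N n) (\<phi> n))"
      by (simp add: alternatives_def)
    then show "(\<Sum>j\<in>alternatives D (N n) (\<phi> n). \<integral>\<sigma>. ?g n j \<sigma> \<partial>\<pi>\<^sub>1) =
        real (card (alternatives D (N n) (\<phi> n))) * BETP f C D \<pi>\<^sub>1 (N n) (\<phi> n)"
      by (auto simp: BETP_def)
  qed (auto simp: alternatives_def)
  \<comment> \<open>All null indices share the parameter value \<open>\<phi>\<^sub>0\<close>, so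
    their means coincide and add up to card times BEFP.\<close>
  moreover have "tendsto_zero_in_prob M (\<lambda>n \<omega>. EFP f C \<phi>\<^sub>0 (N n) (\<phi> n) (\<lambda>j. \<sigma> n j \<omega>) /
      real (card (nulls \<phi>\<^sub>0 (N n) (\<phi> n))) - BEFP f C \<phi>\<^sub>0 \<pi>\<^sub>1)"
    unfolding EFP_def
    by (rule law[OF _ assms(11)]) (auto simp: nulls_def BEFP_def)
  ultimately show ?thesis
    by blast
qed

end
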